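(* Let $c>0$ and $\delta>0$ be real constants and let $F$ be the distribution function of a non-degenerate integrable real random variable such that $\omega_F<\infty$; let $G=1-F$. Then $F\in\mathbf{P}_{c,\delta}$ if and only if the following two conditions hold: (a) $\mathrm{supp}(F)=\{a_0,a_1,\ldots,a_m\}$ where $m\ge1$, $a_0=\alpha_F$, $\delta<a_{n+1}-a_n<1/c$ for $n=0,1,\ldots,m-2$, $\delta<a_m-a_{m-1}=1/c$, and $a_m=\omega_F$; (b) $G(a_0)\in(0,1)$ and $$G(a_n)=G(a_0)\prod_{i=0}^{n-1}\bigl(1-c(a_{i+1}-a_i)\bigr),\qquad n=1,\ldots,m-1.$$
   Context: Let $(X_n)_{n\ge1}$ be independent, identically distributed, integrable real random variables with non-degenerate distribution function $F$, and let $G=1-F$. Put $\mathcal{F}_n=\sigma(X_1,\ldots,X_n)$ and $M_n=\max\{X_1,\ldots,X_n\}$. For a real $\delta\neq0$ let $I_1=1$ and, for $n\ge2$, let $I_n=1$ if $X_n>M_{n-1}+\delta$ and $I_n=0$ otherwise; let $N_n=\sum_{k=1}^n I_k$ (the number of $\delta$-records among the first $n$ observations). For real $c>0$ and $\delta\ne0$, write $F\in\mathbf{P}_{c,\delta}$ if $F$ is such a (non-degenerate, finite-mean) distribution function and $(N_n-cM_n)_{n\ge1}$ is an $(\mathcal{F}_n)$-martingale. The support is $\mathrm{supp}(F)=\{x\in\mathbb{R}:F(x+\epsilon)-F(x-\epsilon)>0\ \forall\epsilon>0\}$; $\alpha_F=\inf\mathrm{supp}(F)$ and $\omega_F=\sup\mathrm{supp}(F)$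 (possibly infinite). *)

theory Defs
  imports "HOL-Probability.Probability"
begin

definition iid_with_df :: "'a measure \<Rightarrow> (nat \<Rightarrow> 'a \<Rightarrow> real) \<Rightarrow> (real \<Rightarrow> real) \<Rightarrow> bool" where
  "iid_with_df M X F \<longleftrightarrow>
     prob_space M \<and>
     prob_space.indep_vars M (\<lambda>_. borel) X {1..} \<and>
     (\<forall>n\<ge>1. cdf (distr M borel (X n)) = F)"

definition degenerate_df :: "(real \<Rightarrow> real) \<Rightarrow> bool" where
  "degenerate_df F \<longleftrightarrow> (\<exists>a. F = (\<lambda>x. if a \<le> x then 1 else 0))"

definition supp :: "(real \<Rightarrow> real) \<Rightarrow> real set" where
  "supp F = {x. \<forall>\<epsilon>>0. F (x + \<epsilon>) - F (x - \<epsilon>) > 0}"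

definition alpha_df :: "(real \<Rightarrow> real) \<Rightarrow> ereal" where
  "alpha_df F = Inf (ereal ` supp F)"

definition omega_df :: "(real \<Rightarrow> real) \<Rightarrow> ereal" where
  "omega_df F = Sup (ereal ` supp F)"

definition natural_filtration ::
    "'a measure \<Rightarrow> (nat \<Rightarrow> 'a \<Rightarrow> real) \<Rightarrow> nat \<Rightarrow> 'a measure" where
  "natural_filtration M X n =
     sigma (space M) {X i -` B \<inter> space M | i B. i \<in> {1..n} \<and> B \<in> sets borel}"

(* Discrete time starts at 1; nothing is required of the index 0. *)
definition martingale_from_1 ::
    "'a measure \<Rightarrow> (nat \<Rightarrow> 'a measure) \<Rightarrow> (nat \<Rightarrow> 'a \<Rightarrow> real) \<Rightarrow> bool" where
  "martingale_from_1 M \<F> Y \<longleftrightarrow>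
     (\<forall>n\<ge>1. subalgebra M (\<F> n) \<and> sets (\<F> n) \<subseteq> sets (\<F> (Suc n))) \<and>
     (\<forall>n\<ge>1. Y n \<in> borel_measurable (\<F> n) \<and> integrable M (Y n)) \<and>
     (\<forall>n\<ge>1. AE \<omega> in M. real_cond_exp M (\<F> n) (Y (Suc n)) \<omega> = Y n \<omega>)"

definition running_max :: "(nat \<Rightarrow> 'a \<Rightarrow> real) \<Rightarrow> nat \<Rightarrow> 'a \<Rightarrow> real" where
  "running_max X n \<omega> = Max ((\<lambda>k. X k \<omega>) ` {1..n})"

definition delta_record_ind ::
    "real \<Rightarrow> (nat \<Rightarrow> 'a \<Rightarrow> real) \<Rightarrow> nat \<Rightarrow> 'a \<Rightarrow> nat" where
  "delta_record_ind \<delta> X n \<omega> =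
     (if n = 1 \<or> X n \<omega> > running_max X (n - 1) \<omega> + \<delta> then 1 else 0)"

definition num_delta_records ::
    "real \<Rightarrow> (nat \<Rightarrow> 'a \<Rightarrow> real) \<Rightarrow> nat \<Rightarrow> 'a \<Rightarrow> nat" where
  "num_delta_records \<delta> X n \<omega> = (\<Sum>k=1..n. delta_record_ind \<delta> X k \<omega>)"

(* Membership of F in the class P_{c,\<delta>}, for a given realization X of an i.i.d. sequence
   with distribution function F.  It depends on the realization only through F, since
   the martingale property is a property of the joint law of X; a realization exists
   for every distribution function (see exists_iid_with_df). *)
definition in_P ::
    "'a measure \<Rightarrow> (nat \<Rightarrow> 'a \<Rightarrow> real) \<Rightarrow> real \<Rightarrow> real \<Rightarrow> (real \<Rightarrow> real) \<Rightarrow> bool" where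
  "in_P M X c \<delta> F \<longleftrightarrow>
     c > 0 \<and> \<delta> \<noteq> 0 \<and>
     iid_with_df M X F \<and> \<not> degenerate_df F \<and> (\<forall>n\<ge>1. integrable M (X n)) \<and>
     martingale_from_1 M (natural_filtration M X)
       (\<lambda>n \<omega>. real (num_delta_records \<delta> X n \<omega>) - c * running_max X n \<omega>)"

lemma exists_iid_with_df:
  assumes "real_distribution D"
  shows "\<exists>(M :: (nat \<Rightarrow> real) measure) X. iid_with_df M X (cdf D)"
proof -
  interpret D: real_distribution D by fact
  interpret P: product_prob_space "\<lambda>_::nat. D" UNIV by unfold_locales
  define M where "M = PiM (UNIV :: nat set) (\<lambda>_. D)"
  define X where "X = (\<lambda>(n::nat) (\<omega> :: nat \<Rightarrow> real). \<omega> n)"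
  have M: "prob_space M" unfolding M_def by (rule P.prob_space_axioms)
  interpret M: prob_space M by (rule M)
  have meas: "X i \<in> measurable M borel" for i
    unfolding X_def M_def by (subst measurable_cong_sets[OF refl, of borel D]) auto
  have dist: "distr M borel (X i) = D" for i
  proof -
    have "distr M borel (X i) = distr M D (X i)"
      by (rule distr_cong) auto
    also have "\<dots> = D" unfolding M_def X_def by (rule P.PiM_component) simp
    finally show ?thesis .
  qed
  have sM: "sets M = sets (PiM UNIV (\<lambda>_::nat. borel :: real measure))"
    unfolding M_def by (intro sets_PiM_cong) auto
  have "M.indep_vars (\<lambda>_. borel) X UNIV"
  proof (subst M.indep_vars_iff_distr_eq_PiM)
    have "distr M (PiM UNIV (\<lambda>_. borel)) (\<lambda>x. \<lambda>i\<in>UNIV. X i x) = distr M M (\<lambda>x. x)"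
      using sM by (intro distr_cong) (auto simp: X_def)
    also have "\<dots> = PiM UNIV (\<lambda>i. distr M borel (X i))"
      by (simp add: dist) (simp add: M_def)
    finally show "distr M (PiM UNIV (\<lambda>_. borel)) (\<lambda>x. \<lambda>i\<in>UNIV. X i x) =
        PiM UNIV (\<lambda>i. distr M borel (X i))" .
  qed (auto simp: meas)
  then have "M.indep_vars (\<lambda>_. borel) X {1..}"
    by (rule M.indep_vars_subset) simp
  then have "iid_with_df M X (cdf D)"
    using M dist unfolding iid_with_df_def by simp
  then show ?thesis by blast
qed

end

theory Submission
  imports Defs
begin

text \<open>
  Let \<open>D\<close> be the common law of the observations, and let the drift at a level \<open>x\<close> be
  \<open>D {x + \<delta><..} - c * E (X - x)\<^sup>+\<close>. Given the first \<open>n\<close> observations, with maximum \<open>x\<close>,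
  the next one is a \<open>\<delta>\<close>-record with probability \<open>D {x + \<delta><..}\<close> and raises the maximum by
  \<open>E (X - x)\<^sup>+\<close> on average, so the drift at \<open>x\<close> is the conditional expectation of the increment of
  \<open>N - c M\<close>. Every maximum is one of the observations and the first maximum is the first
  observation; hence the martingale property says exactly that the drift vanishes \<open>D\<close>-almost
  everywhere (lemma \<open>martingale_iff_drift_zero\<close>).

  Suppose it does, and let \<open>x < y\<close> be two zeros of the drift in the support. The mean excess
  \<open>E (X - x)\<^sup>+\<close> is strictly decreasing up to \<open>y\<close>, so the tail drops between \<open>x + \<delta>\<close> and
  \<open>y + \<delta>\<close>: there is a further zero \<open>z\<close> in the support with \<open>x + \<delta> < z \<le> y + \<delta>\<close>. If \<open>y\<close> were within
  \<open>\<delta>\<close> of \<open>x\<close>, then \<open>z\<close> would lie beyond \<open>y\<close> and within \<open>\<delta>\<close> of it, and repeating this produces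
  zeros beyond every bound, which a support bounded above excludes
  (lemma \<open>drift_zero_imp_gap\<close>). So the zeros have gaps larger than \<open>\<delta>\<close>. They are also bounded
  below, because the mean excess tends to infinity at minus infinity while tails are at most 1.
  They are therefore finite in number, and as they carry all the mass they are the support
  (lemma \<open>drift_zero_imp_finite_supp\<close>).

  On a finite support \<open>a 0 < \<dots> < a m\<close> with gaps larger than \<open>\<delta>\<close>, the shift by \<open>\<delta>\<close> does not change
  the tail at a support point, the drift vanishes at \<open>a m\<close>, and its difference between consecutive
  points only involves the tails there. The drift is thus zero on the support if and only if
  \<open>G (a (i + 1)) = G (a i) * (1 - c * (a (i + 1) - a i))\<close> for all \<open>i < m\<close>
  (lemma \<open>drift_zero_on_finite_supp_iff\<close>). This recursion is the product formula together with
  what it says at \<open>i = m - 1\<close>: there the left-hand side is zero, which forces the last gap to be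
  \<open>1 / c\<close>; at smaller \<open>i\<close> it is positive, which forces the gap to be less than \<open>1 / c\<close>.
\<close>

section \<open>Finite sets in a linear order\<close>

text \<open>Dividing by \<open>\<delta>\<close> and rounding down separates points that are more than \<open>\<delta>\<close> apart, so the set
  embeds into a bounded interval of integers.\<close>

lemma finite_if_gaps:
  fixes S :: "real set"
  assumes "\<delta> > 0" "bdd_above S" "bdd_below S"
    and gap: "\<And>x y. x \<in> S \<Longrightarrow> y \<in> S \<Longrightarrow> x < y \<Longrightarrow> \<delta> < y - x"
  shows "finite S"
proof -
  obtain L U where LU: "\<And>x. x \<in> S \<Longrightarrow> L \<le> x" "\<And>x. x \<in> S \<Longrightarrow> x \<le> U"
    using assms(2,3) by (auto simp: bdd_above_def bdd_below_def)
  have "inj_on (\<lambda>x. \<lfloor>x / \<delta>\<rfloor>) S"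
  proof (rule linorder_inj_onI')
    fix x y assume "x \<in> S" "y \<in> S" "x < y"
    with gap[of x y] \<open>\<delta> > 0\<close> have "(x + \<delta>) / \<delta> < y / \<delta>"
      by (intro divide_strict_right_mono) auto
    with \<open>\<delta> > 0\<close> have "x / \<delta> + 1 < y / \<delta>" by (simp add: add_divide_distrib)
    then show "\<lfloor>x / \<delta>\<rfloor> \<noteq> \<lfloor>y / \<delta>\<rfloor>" by linarith
  qed
  moreover have "(\<lambda>x. \<lfloor>x / \<delta>\<rfloor>) ` S \<subseteq> {\<lfloor>L / \<delta>\<rfloor>..\<lfloor>U / \<delta>\<rfloor>}"
    using LU \<open>\<delta> > 0\<close> by (auto intro!: floor_mono divide_right_mono)
  ultimately show ?thesis
    using finite_imageD finite_subset finite_atLeastAtMost_int by metis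
qed

lemma finite_set_strict_mono_enumeration:
  fixes S :: "'a :: linorder set"
  assumes "finite S" "S \<noteq> {}"
  obtains m a where "S = a ` {0..m::nat}" and "\<And>i j. i < j \<Longrightarrow> j \<le> m \<Longrightarrow> a i < a j"
proof
  let ?xs = "sorted_list_of_set S"
  have "set ?xs = S" using assms by simp
  then have len: "length ?xs > 0" using assms(2) by fastforce
  then have "{0..length ?xs - 1} = {0..<length ?xs}" by auto
  then show "S = (\<lambda>i. ?xs ! i) ` {0..length ?xs - 1}"
    using \<open>set ?xs = S\<close> nth_image[of "length ?xs" ?xs] by (simp add: lessThan_atLeast0)
  show "?xs ! i < ?xs ! j" if "i < j" "j \<le> length ?xs - 1" for i j
    using that len sorted_wrt_nth_less[of "(<)" ?xs i j] strict_sorted_list_of_set[of S] by auto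
qed

section \<open>Distributions on the real line: support, tail and mean excess\<close>

lemma bdd_above_supp_if_omega_finite:
  assumes "omega_df F < \<infinity>"
  shows "bdd_above (supp F)"
proof -
  obtain n :: nat where n: "omega_df F < ereal (real n)"
    using assms less_PInf_Ex_of_nat[of "omega_df F"] by auto
  have "s \<le> real n" if "s \<in> supp F" for s
  proof -
    have "ereal s \<le> omega_df F"
      unfolding omega_df_def using that by (intro Sup_upper) auto
    with n have "ereal s < ereal (real n)" by (rule le_less_trans[rotated])
    then show ?thesis by simp
  qed
  then show ?thesis by (auto simp: bdd_above_def)
qed

definition tail :: "real measure \<Rightarrow> real \<Rightarrow> real" where
  "tail D x = measure D {x<..}"

definition mean_excess :: "real measure \<Rightarrow> real \<Rightarrow> real" where
  "mean_excess D x = (\<integral>y. max (y - x) 0 \<partial>D)"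

context real_distribution
begin

lemma tail_eq_cdf: "tail M x = 1 - cdf M x"
proof -
  have "{x<..} = space M - {..x}" by auto
  then show ?thesis
    unfolding tail_def cdf_def2 by (simp only: prob_compl[of "{..x}"] events_eq_borel atMost_borel)
qed

lemma tail_eq_integral: "tail M x = (\<integral>y. of_bool (x < y) \<partial>M)"
proof -
  have "(\<lambda>y. of_bool (x < y)) = (indicator {x<..} :: real \<Rightarrow> real)"
    by (auto simp: indicator_def)
  then show ?thesis by (simp add: tail_def)
qed

lemma tail_diff:
  assumes "x \<le> y"
  shows "tail M x - tail M y = measure M {x<..y}"
  using assms cdf_diff_eq[of x y] by (cases "x = y") (auto simp: tail_eq_cdf)

lemma mem_supp_iff: "x \<in> supp (cdf M) \<longleftrightarrow> (\<forall>\<epsilon>>0. measure M {x - \<epsilon><..x + \<epsilon>} > 0)"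
proof -
  have "cdf M (x + \<epsilon>) - cdf M (x - \<epsilon>) = measure M {x - \<epsilon><..x + \<epsilon>}" if "\<epsilon> > 0" for \<epsilon>
    using that by (intro cdf_diff_eq) simp
  then show ?thesis unfolding supp_def mem_Collect_eq by metis
qed

text \<open>Each point outside the support has a null neighbourhood; as the line is second countable,
  countably many of these neighbourhoods cover the complement of the support.\<close>

lemma AE_mem_supp: "AE x in M. x \<in> supp (cdf M)"
proof -
  define \<F> where "\<F> = {{x - \<epsilon><..<x + \<epsilon>} | x \<epsilon>. measure M {x - \<epsilon><..x + \<epsilon>} = 0}"
  have "\<And>S. S \<in> \<F> \<Longrightarrow> open S" unfolding \<F>_def by auto
  then obtain \<F>' where F': "\<F>' \<subseteq> \<F>" "countable \<F>'" "\<Union>\<F>' = \<Union>\<F>"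
    by (rule Lindelof)
  have "AE x in M. \<forall>S\<in>\<F>'. x \<notin> S"
  proof (subst AE_ball_countable[OF F'(2)], intro ballI)
    fix S assume "S \<in> \<F>'"
    then obtain x \<epsilon> where S: "S = {x - \<epsilon><..<x + \<epsilon>}" "measure M {x - \<epsilon><..x + \<epsilon>} = 0"
      using F'(1) by (auto simp: \<F>_def)
    have "AE y in M. y \<notin> {x - \<epsilon><..x + \<epsilon>}"
      by (rule AE_not_in) (use S in \<open>simp add: null_sets_def emeasure_eq_measure\<close>)
    then show "AE y in M. y \<notin> S" by eventually_elim (auto simp: S)
  qed
  then show ?thesis
  proof eventually_elim
    case (elim x)
    show ?case
    proof (rule ccontr)
      assume "x \<notin> supp (cdf M)"
      then obtain \<epsilon> where e: "\<epsilon> > 0" "measure M {x - \<epsilon><..x + \<epsilon>} = 0"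
        using zero_less_measure_iff by (auto simp: mem_supp_iff)
      then have "x \<in> \<Union>\<F>" unfolding \<F>_def by (auto intro!: exI[of _ "{x - \<epsilon><..<x + \<epsilon>}"])
      with F'(3) elim show False by auto
    qed
  qed
qed

lemma AE_ex_mem:
  assumes "AE x in M. x \<in> S" and "measure M I > 0"
  shows "\<exists>x\<in>S. x \<in> I"
proof (rule ccontr)
  assume no: "\<not> ?thesis"
  have "AE x in M. x \<notin> I" using assms(1) by eventually_elim (use no in auto)
  then have "measure M I = 0"
    using prob_eq_0[of I] measure_notin_sets[of I M] by blast
  with assms(2) show False by simp
qed

lemma closed_AE_imp_supp_subset:
  assumes "closed S" and "AE x in M. x \<in> S"
  shows "supp (cdf M) \<subseteq> S"
proof
  fix x assume x: "x \<in> supp (cdf M)"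
  show "x \<in> S"
  proof (rule ccontr)
    assume "x \<notin> S"
    then obtain e where e: "e > 0" "ball x e \<subseteq> - S"
      using \<open>closed S\<close> open_contains_ball[of "- S"] by (auto simp: open_Compl)
    have "measure M {x - e/2<..x + e/2} > 0" using x e by (auto simp: mem_supp_iff)
    from AE_ex_mem[OF assms(2) this] obtain y where "y \<in> S" "x - e/2 < y" "y \<le> x + e/2" by auto
    moreover from this e have "y \<in> ball x e" by (auto simp: dist_real_def)
    ultimately show False using e by auto
  qed
qed

lemma measure_eq_0_if_no_supp:
  assumes "I \<inter> supp (cdf M) = {}"
  shows "measure M I = 0"
  using AE_ex_mem[OF AE_mem_supp, of I] assms by (force simp: zero_less_measure_iff)

lemma tail_pos_below_supp:
  assumes "x < s" and "s \<in> supp (cdf M)"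
  shows "tail M x > 0"
proof -
  have "0 < measure M {s - (s - x)<..s + (s - x)}"
    using assms unfolding mem_supp_iff by (metis diff_gt_0_iff_gt)
  also have "\<dots> \<le> tail M x" unfolding tail_def by (rule finite_measure_mono) auto
  finally show ?thesis .
qed

lemma tail_eq_0_above_supp:
  assumes "\<And>s. s \<in> supp (cdf M) \<Longrightarrow> s \<le> x"
  shows "tail M x = 0"
  unfolding tail_def using assms by (intro measure_eq_0_if_no_supp) force

lemma tail_le_1: "tail M x \<le> 1" by (simp add: tail_def)

lemma supp_nonempty: "supp (cdf M) \<noteq> {}"
  using AE_ex_mem[OF AE_mem_supp, of UNIV] prob_space by auto

lemma supp_singleton_imp_degenerate:
  assumes "supp (cdf M) = {x}"
  shows "degenerate_df (cdf M)"
  unfolding degenerate_df_def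
proof (intro exI[of _ x] ext)
  fix t
  show "cdf M t = (if x \<le> t then 1 else 0)"
  proof (cases "x \<le> t")
    case True
    then have "tail M t = 0" by (intro tail_eq_0_above_supp) (simp add: assms)
    then show ?thesis using True by (simp add: tail_eq_cdf)
  next
    case False
    then have "measure M {..t} = 0" by (intro measure_eq_0_if_no_supp) (auto simp: assms)
    then show ?thesis using False by (simp add: cdf_def2)
  qed
qed

text \<open>Every neighbourhood of \<open>x\<close> has mass, and close to \<open>x\<close> none of it lies to the right.\<close>

lemma tail_less_1_if_right_isolated:
  assumes x: "x \<in> supp (cdf M)" and "x < y" and gap: "{x<..<y} \<inter> supp (cdf M) = {}"
  shows "tail M x < 1"
proof -
  define e where "e = (y - x) / 2"
  have e: "e > 0" "x + e < y" using \<open>x < y\<close> by (auto simp: e_def field_simps)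
  have "tail M x - tail M (x + e) = measure M {x<..x + e}"
    using e by (intro tail_diff) simp
  also have "\<dots> = 0"
    using gap e by (intro measure_eq_0_if_no_supp) force
  finally have "tail M x = tail M (x + e)" by simp
  moreover have "0 < measure M {x - e<..x + e}" using x e by (auto simp: mem_supp_iff)
  moreover have "tail M (x - e) - tail M (x + e) = measure M {x - e<..x + e}"
    using e by (intro tail_diff) simp
  ultimately show ?thesis using tail_le_1[of "x - e"] by linarith
qed

lemma mean_excess_nonneg: "mean_excess M x \<ge> 0"
  unfolding mean_excess_def by (rule Bochner_Integration.integral_nonneg) simp

lemma mean_excess_eq_0_above_supp:
  assumes "\<And>s. s \<in> supp (cdf M) \<Longrightarrow> s \<le> x"
  shows "mean_excess M x = 0"
proof -
  have "AE t in M. max (t - x) 0 = 0"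
    using AE_mem_supp by eventually_elim (use assms in force)
  then show ?thesis unfolding mean_excess_def by (simp add: integral_eq_zero_AE)
qed

context
  assumes int: "integrable M (\<lambda>x. x)"
begin

lemma integrable_excess: "integrable M (\<lambda>y. max (y - x) 0)"
  using int by simp

text \<open>The difference of the two excesses is nonnegative everywhere, and at least \<open>z - x\<close> on the event that
  \<open>z\<close> is exceeded. Taking \<open>z\<close> strictly between \<open>x\<close> and a support point \<open>y\<close> gives a strict decrease;
  taking \<open>y = z\<close> and letting \<open>x\<close> tend to minus infinity gives unboundedness.\<close>

lemma mean_excess_diff_ge:
  assumes "x \<le> z" "z \<le> y"
  shows "(z - x) * tail M z \<le> mean_excess M x - mean_excess M y"
proof -
  have "(z - x) * tail M z = (\<integral>t. (z - x) * indicator {z<..} t \<partial>M)"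
    by (simp add: tail_def)
  also have "\<dots> \<le> (\<integral>t. max (t - x) 0 - max (t - y) 0 \<partial>M)"
    using assms integrable_excess
    by (intro integral_mono Bochner_Integration.integrable_diff integrable_mult_right integrable_real_indicator)
      (auto simp: indicator_def emeasure_eq_measure)
  also have "\<dots> = mean_excess M x - mean_excess M y"
    unfolding mean_excess_def by (rule Bochner_Integration.integral_diff; rule integrable_excess)
  finally show ?thesis .
qed

text \<open>The derivative of the mean excess is minus the tail, and the tail is constant across a gap of the
  support.\<close>

lemma mean_excess_diff_across_gap:
  assumes "x \<le> y" and gap: "{x<..<y} \<inter> supp (cdf M) = {}"
  shows "mean_excess M x - mean_excess M y = (y - x) * tail M x"
proof -
  have "mean_excess M x - mean_excess M y = (\<integral>t. max (t - x) 0 - max (t - y) 0 \<partial>M)"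
    unfolding mean_excess_def by (rule Bochner_Integration.integral_diff[symmetric]; rule integrable_excess)
  also have "\<dots> = (\<integral>t. (y - x) * indicator {x<..} t \<partial>M)"
  proof (rule integral_cong_AE)
    show "AE t in M. max (t - x) 0 - max (t - y) 0 = (y - x) * indicator {x<..} t"
      using AE_mem_supp
    proof eventually_elim
      case (elim t)
      then have "t \<le> x \<or> y \<le> t" using gap by force
      then show ?case using \<open>x \<le> y\<close> by (auto simp: indicator_def)
    qed
  qed measurable
  also have "\<dots> = (y - x) * tail M x" by (simp add: tail_def)
  finally show ?thesis .
qed

end

end

section \<open>The martingale property as vanishing drift\<close>

definition drift :: "real \<Rightarrow> real \<Rightarrow> real measure \<Rightarrow> real \<Rightarrow> real" where
  "drift c \<delta> D x = tail D (x + \<delta>) - c * mean_excess D x"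

text \<open>Independence makes the joint law of \<open>(U, 1\<^sub>B)\<close> and \<open>Y\<close> a product measure for every event \<open>B\<close> of
  the conditioning \<open>\<sigma>\<close>-algebra. By Fubini, integrating out \<open>Y\<close> first leaves integrals over \<open>B\<close>
  unchanged, which is what characterizes the conditional expectation.\<close>

lemma (in prob_space) real_cond_exp_of_measurable_and_independent:
  fixes g :: "'b \<times> 'c \<Rightarrow> real"
  assumes sub: "subalgebra M A"
    and U: "U \<in> measurable A S"
    and Y: "Y \<in> measurable M T"
    and indep: "indep_set (sets A) (sigma_sets (space M) {Y -` B \<inter> space M | B. B \<in> sets T})"
    and g: "g \<in> borel_measurable (S \<Otimes>\<^sub>M T)"
    and int: "integrable M (\<lambda>\<omega>. g (U \<omega>, Y \<omega>))"
  shows "AE \<omega> in M. real_cond_exp M A (\<lambda>\<omega>. g (U \<omega>, Y \<omega>)) \<omega> = (\<integral>y. g (U \<omega>, y) \<partial>distr M T Y)"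
proof -
  interpret A: finite_measure_subalgebra M A
    by unfold_locales (rule sub)
  interpret DY: prob_space "distr M T Y" by (rule prob_space_distr[OF Y])
  define \<phi> where "\<phi> u = (\<integral>y. g (u, y) \<partial>distr M T Y)" for u
  have \<phi>[measurable]: "\<phi> \<in> borel_measurable S"
    unfolding \<phi>_def using g by (intro DY.borel_measurable_lebesgue_integral) (simp add: measurable_split_conv)
  have UM: "U \<in> measurable M S" by (rule measurable_from_subalg[OF sub U])
  have spA: "space A = space M" and stA: "sets A \<subseteq> sets M"
    using sub by (auto simp: subalgebra_def)
  have key: "(\<integral>\<omega>. indicator B \<omega> * g (U \<omega>, Y \<omega>) \<partial>M) = (\<integral>\<omega>. indicator B \<omega> * \<phi> (U \<omega>) \<partial>M)
      \<and> integrable M (\<lambda>\<omega>. indicator B \<omega> * \<phi> (U \<omega>))" if B: "B \<in> sets A" for B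
  proof -
    \<comment> \<open>Carrying the indicator of \<open>B\<close> as a coordinate turns the integral over \<open>B\<close> into an integral
      with respect to one product law.\<close>
    define W where "W \<omega> = (U \<omega>, indicator B \<omega> :: real)" for \<omega>
    define T' where "T' = S \<Otimes>\<^sub>M (borel :: real measure)"
    have WA: "W \<in> measurable A T'" unfolding W_def T'_def using U B by measurable
    have WM: "W \<in> measurable M T'" by (rule measurable_from_subalg[OF sub WA])
    have BM: "B \<in> sets M" using B stA by auto
    interpret DW: prob_space "distr M T' W" by (rule prob_space_distr[OF WM])
    interpret P: pair_prob_space "distr M T' W" "distr M T Y" ..
    have joint: "distr M T' W \<Otimes>\<^sub>M distr M T Y = distr M (T' \<Otimes>\<^sub>M T) (\<lambda>x. (W x, Y x))"
    proof (rule pair_measure_eqI)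
      fix C E assume "C \<in> sets (distr M T' W)" "E \<in> sets (distr M T Y)"
      then have C: "C \<in> sets T'" and E: "E \<in> sets T" by simp_all
      have "W -` C \<inter> space M \<in> sets A"
        using measurable_sets[OF WA C] by (simp add: spA)
      moreover have "Y -` E \<inter> space M \<in> sigma_sets (space M) {Y -` B \<inter> space M | B. B \<in> sets T}"
        using E by (intro sigma_sets.Basic) auto
      ultimately have "prob ((W -` C \<inter> space M) \<inter> (Y -` E \<inter> space M))
          = prob (W -` C \<inter> space M) * prob (Y -` E \<inter> space M)"
        by (rule indep_setD[OF indep])
      moreover have "(\<lambda>x. (W x, Y x)) -` (C \<times> E) \<inter> space M = (W -` C \<inter> space M) \<inter> (Y -` E \<inter> space M)"
        by auto
      ultimately show "emeasure (distr M T' W) C * emeasure (distr M T Y) E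
          = emeasure (distr M (T' \<Otimes>\<^sub>M T) (\<lambda>x. (W x, Y x))) (C \<times> E)"
        using C E WM Y by (simp add: emeasure_distr emeasure_eq_measure ennreal_mult)
    qed (auto intro: DW.sigma_finite_measure_axioms DY.sigma_finite_measure_axioms)
    define f where "f = (\<lambda>(w, y). snd w * g (fst w, y))"
    have f: "f \<in> borel_measurable (T' \<Otimes>\<^sub>M T)"
      unfolding f_def T'_def using g by measurable
    have WY: "(\<lambda>x. (W x, Y x)) \<in> measurable M (T' \<Otimes>\<^sub>M T)"
      using WM Y by measurable
    have fWY: "f (W \<omega>, Y \<omega>) = indicator B \<omega> * g (U \<omega>, Y \<omega>)" for \<omega>
      by (simp add: f_def W_def)
    have "integrable M (\<lambda>\<omega>. f (W \<omega>, Y \<omega>))"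
      unfolding fWY using integrable_mult_indicator[OF BM int] by simp
    then have fint: "integrable (distr M T' W \<Otimes>\<^sub>M distr M T Y) f"
      unfolding joint by (subst integrable_distr_eq[OF WY f])
    have inner: "(\<integral>y. f (w, y) \<partial>distr M T Y) = snd w * \<phi> (fst w)" for w
      by (simp add: f_def \<phi>_def)
    have m: "(\<lambda>w. snd w * \<phi> (fst w)) \<in> borel_measurable T'"
      unfolding T'_def by measurable
    have "(\<integral>\<omega>. indicator B \<omega> * g (U \<omega>, Y \<omega>) \<partial>M) = integral\<^sup>L (distr M T' W \<Otimes>\<^sub>M distr M T Y) f"
      unfolding joint by (subst integral_distr[OF WY f]) (simp add: fWY)
    also have "\<dots> = (\<integral>w. snd w * \<phi> (fst w) \<partial>distr M T' W)"
      using P.integral_fst'[OF fint] by (simp add: inner)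
    also have "\<dots> = (\<integral>\<omega>. indicator B \<omega> * \<phi> (U \<omega>) \<partial>M)"
      by (subst integral_distr[OF WM m]) (simp add: W_def)
    finally have 1: "(\<integral>\<omega>. indicator B \<omega> * g (U \<omega>, Y \<omega>) \<partial>M) = (\<integral>\<omega>. indicator B \<omega> * \<phi> (U \<omega>) \<partial>M)" .
    have "integrable (distr M T' W) (\<lambda>w. snd w * \<phi> (fst w))"
      using P.integrable_fst'[OF fint] by (simp add: inner)
    then have "integrable M (\<lambda>\<omega>. indicator B \<omega> * \<phi> (U \<omega>))"
      by (subst (asm) integrable_distr_eq[OF WM m]) (simp add: W_def)
    with 1 show ?thesis by simp
  qed
  have "integrable M (\<lambda>\<omega>. indicator (space M) \<omega> * \<phi> (U \<omega>))"
    using key[OF sets.top] by (simp add: spA)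
  then have \<phi>int: "integrable M (\<lambda>\<omega>. \<phi> (U \<omega>))"
    by (rule Bochner_Integration.integrable_cong[OF refl, THEN iffD1, rotated]) simp
  have "AE \<omega> in M. real_cond_exp M A (\<lambda>\<omega>. g (U \<omega>, Y \<omega>)) \<omega> = \<phi> (U \<omega>)"
    using key U by (intro A.real_cond_exp_charact int \<phi>int) (auto simp: set_lebesgue_integral_def)
  then show ?thesis by (simp add: \<phi>_def)
qed

lemma sets_natural_filtration:
  "sets (natural_filtration M X n) =
     sigma_sets (space M) {X i -` B \<inter> space M | i B. i \<in> {1..n} \<and> B \<in> sets borel}"
  unfolding natural_filtration_def by (rule sets_measure_of) auto

lemma space_natural_filtration [simp]: "space (natural_filtration M X n) = space M"
  unfolding natural_filtration_def by (rule space_measure_of) auto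

lemma measurable_natural_filtration:
  assumes "i \<in> {1..n}"
  shows "X i \<in> borel_measurable (natural_filtration M X n)"
  using assms by (intro measurableI) (auto simp: sets_natural_filtration)

lemma natural_filtration_mono:
  assumes "m \<le> n"
  shows "sets (natural_filtration M X m) \<subseteq> sets (natural_filtration M X n)"
  unfolding sets_natural_filtration using assms by (intro sigma_sets_mono') force

lemma subalgebra_natural_filtration:
  assumes "\<And>i. i \<ge> 1 \<Longrightarrow> X i \<in> borel_measurable M"
  shows "subalgebra M (natural_filtration M X n)"
  unfolding subalgebra_def sets_natural_filtration space_natural_filtration
  using assms by (auto intro!: sets.sigma_sets_subset measurable_sets)

lemma running_max_1: "running_max X (Suc 0) \<omega> = X (Suc 0) \<omega>"
  by (simp add: running_max_def)

lemma running_max_Suc: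
  assumes "n \<ge> 1"
  shows "running_max X (Suc n) \<omega> = max (X (Suc n) \<omega>) (running_max X n \<omega>)"
  using assms unfolding running_max_def by (simp add: atLeastAtMostSuc_conv)

lemma running_max_attained:
  assumes "n \<ge> 1"
  obtains k where "k \<ge> 1" "running_max X n \<omega> = X k \<omega>"
proof -
  have "running_max X n \<omega> \<in> (\<lambda>k. X k \<omega>) ` {1..n}"
    unfolding running_max_def using assms by (intro Max_in) auto
  then show ?thesis using that by auto
qed

lemma borel_measurable_running_max:
  assumes "n \<ge> 1"
  shows "running_max X n \<in> borel_measurable (natural_filtration M X n)"
  unfolding running_max_def using assms
  by (intro borel_measurable_Max measurable_natural_filtration) auto

lemma integrable_running_max:
  assumes "\<And>i. i \<ge> 1 \<Longrightarrow> integrable M (X i)" and "n \<ge> 1"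
  shows "integrable M (running_max X n)"
  using assms(2)
proof (induction n rule: dec_induct)
  case base
  have "running_max X 1 = X 1" by (simp add: running_max_1 fun_eq_iff)
  then show ?case using assms(1) by simp
next
  case (step n)
  then have "running_max X (Suc n) = (\<lambda>\<omega>. max (X (Suc n) \<omega>) (running_max X n \<omega>))"
    by (simp add: running_max_Suc fun_eq_iff)
  then show ?case using assms(1)[of "Suc n"] step by simp
qed

lemma borel_measurable_num_delta_records:
  "(\<lambda>\<omega>. real (num_delta_records \<delta> X n \<omega>)) \<in> borel_measurable (natural_filtration M X n)"
proof -
  have "(\<lambda>\<omega>. real (delta_record_ind \<delta> X k \<omega>)) \<in> borel_measurable (natural_filtration M X n)"
    if k: "k \<in> {1..n}" for k
  proof (cases "k = 1")
    case False
    have [measurable]: "X k \<in> borel_measurable (natural_filtration M X n)"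
      using k by (rule measurable_natural_filtration)
    have [measurable]: "running_max X (k - 1) \<in> borel_measurable (natural_filtration M X n)"
    proof (rule measurable_from_subalg[OF _ borel_measurable_running_max])
      show "subalgebra (natural_filtration M X n) (natural_filtration M X (k - 1))"
        unfolding subalgebra_def using k by (intro conjI natural_filtration_mono) auto
    qed (use k False in auto)
    have "(\<lambda>\<omega>. real (delta_record_ind \<delta> X k \<omega>))
        = (\<lambda>\<omega>. if running_max X (k - 1) \<omega> + \<delta> < X k \<omega> then 1 else 0)"
      using False by (simp add: delta_record_ind_def fun_eq_iff)
    also have "\<dots> \<in> borel_measurable (natural_filtration M X n)" by measurable
    finally show ?thesis .
  qed (simp add: delta_record_ind_def)
  then show ?thesis unfolding num_delta_records_def by (simp add: borel_measurable_sum)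
qed

lemma (in prob_space) indep_set_natural_filtration_next:
  assumes "indep_vars (\<lambda>_. borel) X {1..}"
  shows "indep_set (sets (natural_filtration M X n))
    (sigma_sets (space M) {X (Suc n) -` B \<inter> space M | B. B \<in> sets (borel :: real measure)})"
proof -
  let ?E = "\<lambda>i. {X i -` B \<inter> space M | B. B \<in> sets (borel :: real measure)}"
  let ?I = "case_bool {1..n} {Suc n}"
  have "indep_sets ?E {1..}" using assms by (simp add: indep_vars_def2)
  then have "indep_sets ?E (\<Union>j\<in>UNIV. ?I j)"
    by (rule indep_sets_mono_index[rotated]) (auto split: bool.splits)
  then have "indep_sets (\<lambda>j. sigma_sets (space M) (\<Union>i\<in>?I j. ?E i)) UNIV"
  proof (rule indep_sets_collect_sigma)
    show "Int_stable (?E i)" for i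
      by (auto simp: Int_stable_def) (metis (no_types, lifting) Int_assoc Int_left_commute inf.idem sets.Int vimage_Int)
    show "disjoint_family_on ?I UNIV"
      by (auto simp: disjoint_family_on_def split: bool.splits)
  qed
  moreover have "(\<Union>i\<in>{1..n}. ?E i) = {X i -` B \<inter> space M | i B. i \<in> {1..n} \<and> B \<in> sets borel}"
    by blast
  ultimately show ?thesis
    unfolding indep_set_def sets_natural_filtration
    by (elim indep_sets_mono_sets) (auto split: bool.splits)
qed

lemma borel_measurable_drift:
  assumes "real_distribution D"
  shows "drift c \<delta> D \<in> borel_measurable borel"
proof -
  interpret real_distribution D by fact
  have "(\<lambda>x. \<integral>y. max (y - x) 0 \<partial>D) \<in> borel_measurable borel"
    by (intro borel_measurable_lebesgue_integral) measurable
  moreover have "(\<lambda>x. \<integral>y. (of_bool (x + \<delta> < y) :: real) \<partial>D) \<in> borel_measurable borel"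
    unfolding of_bool_def by (intro borel_measurable_lebesgue_integral) measurable
  moreover have "(\<integral>y. (of_bool (x + \<delta> < y) :: real) \<partial>D) = tail D (x + \<delta>)" for x
    by (simp add: tail_eq_integral)
  ultimately show ?thesis
    unfolding drift_def[abs_def] mean_excess_def by simp
qed

text \<open>The increment of the process is a function \<open>g\<close> of the current maximum, which is known at time \<open>n\<close>,
  and of the next observation, which is independent of the past. Its conditional expectation is therefore
  the drift at the current maximum.\<close>

lemma martingale_iff_drift_zero:
  assumes iid: "iid_with_df M X F"
    and int: "\<And>n. n \<ge> 1 \<Longrightarrow> integrable M (X n)"
  shows "martingale_from_1 M (natural_filtration M X)
      (\<lambda>n \<omega>. real (num_delta_records \<delta> X n \<omega>) - c * running_max X n \<omega>)
    \<longleftrightarrow> (AE x in distr M borel (X 1). drift c \<delta> (distr M borel (X 1)) x = 0)"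
proof -
  interpret prob_space M using iid by (simp add: iid_with_df_def)
  have ind: "indep_vars (\<lambda>_. borel) X {1..}" using iid by (simp add: iid_with_df_def)
  have X: "X i \<in> borel_measurable M" if "i \<ge> 1" for i
    using ind that by (simp add: indep_vars_def2)
  define D where "D = distr M borel (X 1)"
  interpret D: real_distribution D unfolding D_def using X[of 1] by (intro real_distribution_distr) simp
  have D: "distr M borel (X i) = D" if "i \<ge> 1" for i
    using iid that X unfolding D_def by (intro cdf_unique real_distribution_distr) (auto simp: iid_with_df_def)
  let ?A = "natural_filtration M X"
  let ?Y = "\<lambda>n \<omega>. real (num_delta_records \<delta> X n \<omega>) - c * running_max X n \<omega>"
  have sub: "subalgebra M (?A n)" for n
    by (rule subalgebra_natural_filtration[OF X])
  have adapted: "?Y n \<in> borel_measurable (?A n)" if "n \<ge> 1" for n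
    using borel_measurable_running_max[OF that] borel_measurable_num_delta_records by measurable
  have intY: "integrable M (?Y n)" if "n \<ge> 1" for n
  proof -
    have "integrable M (\<lambda>\<omega>. real (num_delta_records \<delta> X n \<omega>))"
    proof (rule integrable_const_bound[where B = "real n"])
      have "num_delta_records \<delta> X n \<omega> \<le> n" for \<omega>
        using sum_mono[of "{1..n}" "\<lambda>k. delta_record_ind \<delta> X k \<omega>" "\<lambda>_. 1"]
        by (auto simp: num_delta_records_def delta_record_ind_def)
      then show "AE \<omega> in M. norm (real (num_delta_records \<delta> X n \<omega>)) \<le> real n" by simp
    qed (rule measurable_from_subalg[OF sub borel_measurable_num_delta_records])
    then show ?thesis using integrable_running_max[OF int that] by simp
  qed
  define g where "g = (\<lambda>(m, y). of_bool (m + \<delta> < y) - c * max (y - m) 0 :: real)"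
  have g: "g \<in> borel_measurable (borel \<Otimes>\<^sub>M borel)" unfolding g_def by measurable
  have step: "?Y (Suc n) \<omega> = ?Y n \<omega> + g (running_max X n \<omega>, X (Suc n) \<omega>)" if "n \<ge> 1" for n \<omega>
    using that by (simp add: g_def running_max_Suc num_delta_records_def delta_record_ind_def
        max_def algebra_simps)
  have intD: "integrable D (\<lambda>y. y)"
    using int[of 1] X[of 1] unfolding D_def by (subst integrable_distr_eq) auto
  have g_integral: "(\<integral>y. g (m, y) \<partial>D) = drift c \<delta> D m" for m
  proof -
    have "integrable D (\<lambda>y. max (y - m) 0)" using intD by simp
    moreover have "integrable D (\<lambda>y. of_bool (m + \<delta> < y) :: real)"
      by (rule D.integrable_const_bound[where B = 1]) auto
    ultimately show ?thesis
      unfolding g_def drift_def D.tail_eq_integral mean_excess_def by simp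
  qed
  have cond: "AE \<omega> in M. real_cond_exp M (?A n) (?Y (Suc n)) \<omega> = ?Y n \<omega> + drift c \<delta> D (running_max X n \<omega>)"
    if n: "n \<ge> 1" for n
  proof -
    interpret A: finite_measure_subalgebra M "?A n" by unfold_locales (rule sub)
    have "integrable M (\<lambda>\<omega>. ?Y (Suc n) \<omega> - ?Y n \<omega>)"
      by (intro Bochner_Integration.integrable_diff intY) (use n in auto)
    then have intg: "integrable M (\<lambda>\<omega>. g (running_max X n \<omega>, X (Suc n) \<omega>))"
      unfolding step[OF n] by simp
    have "AE \<omega> in M. real_cond_exp M (?A n) (\<lambda>\<omega>. g (running_max X n \<omega>, X (Suc n) \<omega>)) \<omega>
        = (\<integral>y. g (running_max X n \<omega>, y) \<partial>distr M borel (X (Suc n)))"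
      by (rule real_cond_exp_of_measurable_and_independent[OF sub borel_measurable_running_max[OF n] X
            indep_set_natural_filtration_next[OF ind] g intg]) simp
    moreover have "AE \<omega> in M. real_cond_exp M (?A n) (\<lambda>\<omega>. ?Y n \<omega> + g (running_max X n \<omega>, X (Suc n) \<omega>)) \<omega>
        = real_cond_exp M (?A n) (?Y n) \<omega>
          + real_cond_exp M (?A n) (\<lambda>\<omega>. g (running_max X n \<omega>, X (Suc n) \<omega>)) \<omega>"
      by (rule A.real_cond_exp_add[OF intY[OF n] intg])
    moreover have "AE \<omega> in M. real_cond_exp M (?A n) (?Y n) \<omega> = ?Y n \<omega>"
      by (rule A.real_cond_exp_F_meas[OF intY[OF n] adapted[OF n]])
    ultimately show ?thesis
      unfolding step[OF n] D[of "Suc n", simplified] g_integral by eventually_elim simp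
  qed
  have drift_meas: "drift c \<delta> D \<in> borel_measurable borel"
    by (rule borel_measurable_drift) (rule D.real_distribution_axioms)
  have AE_X: "(AE \<omega> in M. drift c \<delta> D (X k \<omega>) = 0) \<longleftrightarrow> (AE x in D. drift c \<delta> D x = 0)"
    if "k \<ge> 1" for k
    using drift_meas X[OF that] unfolding D[OF that, symmetric]
    by (subst AE_distr_iff) auto
  have "martingale_from_1 M ?A ?Y \<longleftrightarrow> (\<forall>n\<ge>1. AE \<omega> in M. drift c \<delta> D (running_max X n \<omega>) = 0)"
  proof -
    have "(AE \<omega> in M. real_cond_exp M (?A n) (?Y (Suc n)) \<omega> = ?Y n \<omega>) \<longleftrightarrow>
        (AE \<omega> in M. drift c \<delta> D (running_max X n \<omega>) = 0)" if "n \<ge> 1" for n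
    proof
      assume "AE \<omega> in M. real_cond_exp M (?A n) (?Y (Suc n)) \<omega> = ?Y n \<omega>"
      with cond[OF that] show "AE \<omega> in M. drift c \<delta> D (running_max X n \<omega>) = 0"
        by eventually_elim simp
    next
      assume "AE \<omega> in M. drift c \<delta> D (running_max X n \<omega>) = 0"
      with cond[OF that] show "AE \<omega> in M. real_cond_exp M (?A n) (?Y (Suc n)) \<omega> = ?Y n \<omega>"
        by eventually_elim simp
    qed
    then show ?thesis
      unfolding martingale_from_1_def using sub adapted intY by (simp add: natural_filtration_mono)
  qed
  also have "\<dots> \<longleftrightarrow> (AE x in D. drift c \<delta> D x = 0)"
  proof
    assume "\<forall>n\<ge>1. AE \<omega> in M. drift c \<delta> D (running_max X n \<omega>) = 0"
    then have "AE \<omega> in M. drift c \<delta> D (X 1 \<omega>) = 0"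
      by (auto simp: running_max_1 dest!: spec[of _ "1::nat"])
    then show "AE x in D. drift c \<delta> D x = 0" by (simp add: AE_X)
  next
    assume *: "AE x in D. drift c \<delta> D x = 0"
    then have "AE \<omega> in M. \<forall>k. drift c \<delta> D (X (Suc k) \<omega>) = 0"
      unfolding AE_all_countable using AE_X by simp
    then show "\<forall>n\<ge>1. AE \<omega> in M. drift c \<delta> D (running_max X n \<omega>) = 0"
    proof (intro allI impI, elim AE_mp, intro AE_I2 impI)
      fix n \<omega> assume "1 \<le> (n::nat)" and 0: "\<forall>k. drift c \<delta> D (X (Suc k) \<omega>) = 0"
      then obtain k where "k \<ge> 1" "running_max X n \<omega> = X k \<omega>"
        using running_max_attained by metis
      then show "drift c \<delta> D (running_max X n \<omega>) = 0"
        using 0[rule_format, of "k - 1"] by simp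
    qed
  qed
  finally show ?thesis unfolding D_def .
qed

section \<open>Zeros of the drift\<close>

context real_distribution
begin

context
  assumes int: "integrable M (\<lambda>x. x)"
begin

text \<open>Two zeros of the drift within \<open>\<delta>\<close> of each other would generate zeros climbing without bound:
  in the proof, \<open>P\<close> collects the zeros that have another zero at most \<open>\<delta>\<close> to their right, and every
  element of \<open>P\<close> is exceeded by more than \<open>\<delta>\<close> by another one, which is impossible near the supremum.\<close>

lemma drift_zero_imp_gap:
  assumes c: "c > 0" and \<delta>: "\<delta> > 0" and bdd: "bdd_above (supp (cdf M))"
    and AE0: "AE x in M. drift c \<delta> M x = 0"
  defines "S \<equiv> {x \<in> supp (cdf M). drift c \<delta> M x = 0}"
  assumes xy: "x \<in> S" "y \<in> S" "x < y"
  shows "\<delta> < y - x"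
proof (rule ccontr)
  have AE_S: "AE x in M. x \<in> S"
    using AE0 AE_mem_supp by eventually_elim (simp add: S_def)
  have jump: "\<exists>z\<in>S. x + \<delta> < z \<and> z \<le> y + \<delta>" if "x \<in> S" "y \<in> S" "x < y" for x y
  proof -
    \<comment> \<open>Only points strictly below the support point \<open>y\<close> are sure to have a positive tail, hence
      the midpoint.\<close>
    define z where "z = (x + y) / 2"
    have "0 < c * ((z - x) * tail M z)"
      using that c tail_pos_below_supp[of z y] by (simp add: z_def S_def)
    also have "\<dots> \<le> c * (mean_excess M x - mean_excess M y)"
      using that c mean_excess_diff_ge[OF int, of x z y] by (intro mult_left_mono) (auto simp: z_def)
    also have "\<dots> = tail M (x + \<delta>) - tail M (y + \<delta>)"
      using that by (simp add: S_def drift_def algebra_simps)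
    also have "\<dots> = measure M {x + \<delta><..y + \<delta>}"
      using that by (intro tail_diff) simp
    finally show ?thesis using AE_ex_mem[OF AE_S] by force
  qed
  define P where "P = {x \<in> S. \<exists>y\<in>S. x < y \<and> y \<le> x + \<delta>}"
  have climb: "\<exists>z\<in>P. x + \<delta> < z" if "x \<in> P" for x
  proof -
    from that obtain y where y: "x \<in> S" "y \<in> S" "x < y" "y \<le> x + \<delta>" by (auto simp: P_def)
    obtain z where z: "z \<in> S" "x + \<delta> < z" "z \<le> y + \<delta>" using jump[OF y(1-3)] by auto
    obtain w where w: "w \<in> S" "y + \<delta> < w" "w \<le> z + \<delta>" using jump[of y z] y z by auto
    have "z \<in> P" unfolding P_def using z w by (auto intro!: bexI[of _ w])
    with z show ?thesis by auto
  qed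
  assume "\<not> \<delta> < y - x"
  then have "x \<in> P" using xy by (auto simp: P_def)
  have bP: "bdd_above P" by (rule bdd_above_mono[OF bdd]) (auto simp: P_def S_def)
  obtain u where u: "u \<in> P" "Sup P - \<delta> < u"
    using less_cSupD[of P "Sup P - \<delta>"] \<open>x \<in> P\<close> \<delta> by auto
  obtain v where "v \<in> P" "u + \<delta> < v" using climb[OF u(1)] by auto
  with u cSup_upper[OF _ bP, of v] show False by simp
qed

text \<open>By hypothesis the zeros of the drift carry all the mass, but they need not be closed, so they could a
  priori miss support points. Finiteness closes them.\<close>

lemma drift_zero_imp_finite_supp:
  assumes c: "c > 0" and \<delta>: "\<delta> > 0" and bdd: "bdd_above (supp (cdf M))"
    and AE0: "AE x in M. drift c \<delta> M x = 0"
  shows "finite (supp (cdf M))"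
    and "\<And>x. x \<in> supp (cdf M) \<Longrightarrow> drift c \<delta> M x = 0"
    and "\<And>x y. x \<in> supp (cdf M) \<Longrightarrow> y \<in> supp (cdf M) \<Longrightarrow> x < y \<Longrightarrow> \<delta> < y - x"
proof -
  define S where "S = {x \<in> supp (cdf M). drift c \<delta> M x = 0}"
  have AE_S: "AE x in M. x \<in> S"
    using AE0 AE_mem_supp by eventually_elim (simp add: S_def)
  have gap: "\<And>x y. x \<in> S \<Longrightarrow> y \<in> S \<Longrightarrow> x < y \<Longrightarrow> \<delta> < y - x"
    unfolding S_def by (rule drift_zero_imp_gap[OF c \<delta> bdd AE0])
  obtain s where s: "s \<in> supp (cdf M)"
    using AE_ex_mem[OF AE_mem_supp, of UNIV] prob_space by auto
  define z where "z = s - 1"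
  have tz: "tail M z > 0" by (rule tail_pos_below_supp[OF _ s]) (simp add: z_def)
  have "bdd_below S"
  proof (rule bdd_belowI)
    fix x assume x: "x \<in> S"
    \<comment> \<open>For \<open>x \<le> z\<close> the mean excess at \<open>x\<close> is at least \<open>(z - x) * tail M z\<close>, whereas a zero of the
      drift has mean excess at most \<open>1 / c\<close>.\<close>
    show "min z (z - 1 / (c * tail M z)) \<le> x"
    proof (cases "x \<le> z")
      case True
      have "c * ((z - x) * tail M z) \<le> c * mean_excess M x"
        using mean_excess_diff_ge[OF int, of x z z] mean_excess_nonneg[of z] True c by (intro mult_left_mono) auto
      also have "\<dots> = tail M (x + \<delta>)" using x by (simp add: S_def drift_def)
      also have "\<dots> \<le> 1" by (rule tail_le_1)
      finally have "z - x \<le> 1 / (c * tail M z)" using c tz by (simp add: field_simps)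
      then show ?thesis by simp
    qed simp
  qed
  moreover have "bdd_above S" by (rule bdd_above_mono[OF bdd]) (auto simp: S_def)
  ultimately have fin: "finite S" using finite_if_gaps[OF \<delta> _ _ gap] by blast
  then have "supp (cdf M) \<subseteq> S"
    using AE_S by (intro closed_AE_imp_supp_subset finite_imp_closed)
  then have eq: "supp (cdf M) = S" by (auto simp: S_def)
  show "finite (supp (cdf M))" using fin eq by simp
  show "drift c \<delta> M x = 0" if "x \<in> supp (cdf M)" for x
    using that unfolding eq by (simp add: S_def)
  show "\<delta> < y - x" if "x \<in> supp (cdf M)" "y \<in> supp (cdf M)" "x < y" for x y
    using that unfolding eq by (rule gap)
qed

text \<open>The integral equation between tail and mean excess becomes a one-step recursion after
  taking differences, with no boundary term because both sides vanish at the top of the support.\<close>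

lemma drift_zero_on_finite_supp_iff:
  fixes a :: "nat \<Rightarrow> real"
  assumes supp: "supp (cdf M) = a ` {0..m}" and \<delta>: "\<delta> > 0"
    and gap: "\<And>i. i < m \<Longrightarrow> \<delta> < a (i + 1) - a i"
  shows "(\<forall>x\<in>supp (cdf M). drift c \<delta> M x = 0) \<longleftrightarrow>
    (\<forall>i<m. tail M (a (i + 1)) = tail M (a i) * (1 - c * (a (i + 1) - a i)))"
proof -
  have less: "a i + \<delta> < a j" if "i < j" "j \<le> m" for i j
    using that
  proof (induct j)
    case (Suc j)
    then show ?case using gap[of j] \<delta> by (cases "i = j") auto
  qed simp
  have mono: "a i \<le> a j" if "i \<le> j" "j \<le> m" for i j
    using less[of i j] that \<delta> by (cases "i = j") auto
  have beyond: "s \<le> a m" if "s \<in> supp (cdf M)" for s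
    using that mono unfolding supp by auto
  have tail_\<delta>: "tail M (a i + \<delta>) = tail M (a i)" if "i \<le> m" for i
  proof -
    have "{a i<..a i + \<delta>} \<inter> supp (cdf M) = {}"
    proof -
      have "a j \<le> a i \<or> a i + \<delta> < a j" if "j \<le> m" for j
        using mono[of j i] less[of i j] that \<open>i \<le> m\<close> by linarith
      then show ?thesis unfolding supp by force
    qed
    then show ?thesis using tail_diff[of "a i" "a i + \<delta>"] \<delta> measure_eq_0_if_no_supp by simp
  qed
  have drift_a: "drift c \<delta> M (a i) = tail M (a i) - c * mean_excess M (a i)" if "i \<le> m" for i
    using tail_\<delta>[OF that] by (simp add: drift_def)
  have last: "drift c \<delta> M (a m) = 0"
    using drift_a[of m] tail_eq_0_above_supp[of "a m"] mean_excess_eq_0_above_supp[of "a m"] beyond by simp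
  have step: "drift c \<delta> M (a i) - drift c \<delta> M (a (i + 1))
      = tail M (a i) * (1 - c * (a (i + 1) - a i)) - tail M (a (i + 1))" if "i < m" for i
  proof -
    have "{a i<..<a (i + 1)} \<inter> supp (cdf M) = {}"
    proof -
      have "a j \<le> a i \<or> a (i + 1) \<le> a j" if "j \<le> m" for j
        using mono[of j i] mono[of "i + 1" j] that \<open>i < m\<close> by linarith
      then show ?thesis unfolding supp by force
    qed
    then have "mean_excess M (a i) - mean_excess M (a (i + 1)) = (a (i + 1) - a i) * tail M (a i)"
      using gap[OF that] \<delta> by (intro mean_excess_diff_across_gap[OF int]) auto
    then have "c * mean_excess M (a (i + 1)) = c * mean_excess M (a i) - c * ((a (i + 1) - a i) * tail M (a i))"
      by (simp flip: right_diff_distrib)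
    then show ?thesis using drift_a[of i] drift_a[of "i + 1"] that by (simp add: algebra_simps)
  qed
  have "(\<forall>x\<in>supp (cdf M). drift c \<delta> M x = 0) \<longleftrightarrow> (\<forall>i\<le>m. drift c \<delta> M (a i) = 0)"
    by (auto simp: supp)
  also have "\<dots> \<longleftrightarrow> (\<forall>i<m. drift c \<delta> M (a i) = drift c \<delta> M (a (i + 1)))"
  proof
    assume eq: "\<forall>i<m. drift c \<delta> M (a i) = drift c \<delta> M (a (i + 1))"
    show "\<forall>i\<le>m. drift c \<delta> M (a i) = 0"
    proof (intro allI impI)
      fix i assume "i \<le> m"
      then show "drift c \<delta> M (a i) = 0"
        by (induction i rule: inc_induct) (use last eq in auto)
    qed
  qed auto
  also have "\<dots> \<longleftrightarrow> (\<forall>i<m. tail M (a (i + 1)) = tail M (a i) * (1 - c * (a (i + 1) - a i)))"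
    using step by (metis (no_types, lifting) eq_iff_diff_eq_0)
  finally show ?thesis .
qed

end

end

section \<open>The characterization\<close>

theorem theorem4:
  fixes M :: "'a measure" and X :: "nat \<Rightarrow> 'a \<Rightarrow> real"
    and F G :: "real \<Rightarrow> real" and c \<delta> :: real
  assumes "c > 0" and "\<delta> > 0"
    and "iid_with_df M X F"
    and "\<forall>n\<ge>1. integrable M (X n)"
    and "\<not> degenerate_df F"
    and "omega_df F < \<infinity>"
    and "G = (\<lambda>x. 1 - F x)"
  shows "in_P M X c \<delta> F \<longleftrightarrow>
    (\<exists>(m::nat) (a :: nat \<Rightarrow> real).
       (m \<ge> 1 \<and>
        supp F = a ` {0..m} \<and>
        ereal (a 0) = alpha_df F \<and>
        (\<forall>n. n + 2 \<le> m \<longrightarrow> \<delta> < a (n + 1) - a n \<and> a (n + 1) - a n < 1 / c) \<and>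
        \<delta> < a m - a (m - 1) \<and> a m - a (m - 1) = 1 / c \<and>
        ereal (a m) = omega_df F) \<and>
       (0 < G (a 0) \<and> G (a 0) < 1 \<and>
        (\<forall>n\<in>{1..m - 1}.
           G (a n) = G (a 0) * (\<Prod>i = 0..<n. 1 - c * (a (i + 1) - a i)))))"
    (is "_ \<longleftrightarrow> (\<exists>m a. ?supp_cond m a \<and> ?tail_cond m a)")
proof -
  note c = \<open>c > 0\<close> and \<delta> = \<open>\<delta> > 0\<close>
  interpret prob_space M using assms(3) by (simp add: iid_with_df_def)
  have X1: "X 1 \<in> borel_measurable M"
    using assms(3) by (simp add: iid_with_df_def indep_vars_def2)
  define D where "D = distr M borel (X 1)"
  interpret D: real_distribution D
    unfolding D_def using X1 by (intro real_distribution_distr) simp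
  have F: "F = cdf D" using assms(3) by (simp add: iid_with_df_def D_def)
  have G: "G = tail D" using assms(7) by (simp add: F D.tail_eq_cdf fun_eq_iff)
  have intD: "integrable D (\<lambda>y. y)"
    using assms(4) X1 unfolding D_def by (subst integrable_distr_eq) auto
  have "in_P M X c \<delta> F \<longleftrightarrow> (AE x in D. drift c \<delta> D x = 0)"
    using martingale_iff_drift_zero[OF assms(3), of \<delta> c] assms unfolding in_P_def D_def by auto
  also have "\<dots> \<longleftrightarrow> (\<exists>m a. ?supp_cond m a \<and> ?tail_cond m a)"
  proof
    assume AE0: "AE x in D. drift c \<delta> D x = 0"
    have bdd: "bdd_above (supp (cdf D))"
      using bdd_above_supp_if_omega_finite assms(6) F by simp
    note fin = D.drift_zero_imp_finite_supp[OF intD c \<delta> bdd AE0]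
    obtain m a where a: "supp (cdf D) = a ` {0..m::nat}"
      and less: "\<And>i j. i < j \<Longrightarrow> j \<le> m \<Longrightarrow> a i < a j"
      using finite_set_strict_mono_enumeration[OF fin(1) D.supp_nonempty] by metis
    have mem: "a i \<in> supp (cdf D)" if "i \<le> m" for i using a that by auto
    have le: "a i \<le> a j" if "i \<le> j" "j \<le> m" for i j
      using less[of i j] that by (cases "i = j") auto
    have gap: "\<delta> < a (i + 1) - a i" if "i < m" for i
      using that by (intro fin(3) mem less) auto
    have rec: "\<forall>i<m. tail D (a (i + 1)) = tail D (a i) * (1 - c * (a (i + 1) - a i))"
      using D.drift_zero_on_finite_supp_iff[OF intD a \<delta> gap] fin(2) by blast
    have pos: "tail D (a i) > 0" if "i < m" for i
      using that by (intro D.tail_pos_below_supp[OF _ mem[of m]] less) auto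
    have m: "m \<ge> 1"
    proof (rule ccontr)
      assume "\<not> m \<ge> 1"
      then have "m = 0" by simp
      then have "supp (cdf D) = {a 0}" using a by simp
      then show False using D.supp_singleton_imp_degenerate assms(5) F by simp
    qed
    have "tail D (a m) = 0"
      using le a by (intro D.tail_eq_0_above_supp) auto
    then have "tail D (a (m - 1)) * (1 - c * (a m - a (m - 1))) = 0"
      using rec[rule_format, of "m - 1"] m by simp
    then have "c * (a m - a (m - 1)) = 1"
      using pos[of "m - 1"] m by simp
    then have last: "a m - a (m - 1) = 1 / c"
      using c by (simp add: eq_divide_eq mult.commute)
    have short: "a (n + 1) - a n < 1 / c" if "n + 2 \<le> m" for n
    proof -
      have "0 < tail D (a n) * (1 - c * (a (n + 1) - a n))"
        using rec[rule_format, of n] pos[of "n + 1"] that by simp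
      then have "0 < 1 - c * (a (n + 1) - a n)"
        using pos[of n] that by (simp add: zero_less_mult_iff)
      then show ?thesis using c by (simp add: less_divide_eq mult.commute)
    qed
    have prod: "tail D (a n) = tail D (a 0) * (\<Prod>i = 0..<n. 1 - c * (a (i + 1) - a i))" if "n \<le> m" for n
      using that
    proof (induction n)
      case (Suc n)
      then show ?case using rec[rule_format, of n] by (simp add: mult.assoc)
    qed simp
    have alpha: "ereal (a 0) = alpha_df F"
      unfolding alpha_df_def F a by (rule Inf_eqI[symmetric]) (use le in auto)
    have omega: "ereal (a m) = omega_df F"
      unfolding omega_df_def F a by (rule Sup_eqI[symmetric]) (use le in auto)
    have less1: "tail D (a 0) < 1"
    proof (rule D.tail_less_1_if_right_isolated[of _ "a 0 + \<delta>"])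
      show "{a 0<..<a 0 + \<delta>} \<inter> supp (cdf D) = {}"
        using fin(3)[OF mem[of 0]] by force
    qed (use \<delta> mem in auto)
    have "?supp_cond m a"
      using m a alpha omega last short gap[of "m - 1"] gap F by auto
    moreover have "?tail_cond m a"
    proof (intro conjI ballI)
      show "0 < G (a 0)" "G (a 0) < 1" using pos[of 0] m less1 by (simp_all add: G)
      show "G (a n) = G (a 0) * (\<Prod>i = 0..<n. 1 - c * (a (i + 1) - a i))" if "n \<in> {1..m - 1}" for n
        unfolding G using that by (intro prod) auto
    qed
    ultimately have "?supp_cond m a \<and> ?tail_cond m a" by (rule conjI)
    then show "\<exists>m a. ?supp_cond m a \<and> ?tail_cond m a" by (intro exI)
  next
    assume "\<exists>m a. ?supp_cond m a \<and> ?tail_cond m a"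
    then obtain m a where ma: "?supp_cond m a \<and> ?tail_cond m a" by (elim exE) (rule that)
    have "supp F = a ` {0..m}" using ma by (elim conjE)
    then have a: "supp (cdf D) = a ` {0..m}" using F by simp
    have inner: "\<forall>n. n + 2 \<le> m \<longrightarrow> \<delta> < a (n + 1) - a n \<and> a (n + 1) - a n < 1 / c"
      using ma by (elim conjE)
    have outer: "\<delta> < a m - a (m - 1)" using ma by (elim conjE)
    have last: "a m - a (m - 1) = 1 / c" using ma by (elim conjE)
    have omega: "ereal (a m) = omega_df F" using ma by (elim conjE)
    have tails: "\<forall>n\<in>{1..m - 1}. G (a n) = G (a 0) * (\<Prod>i = 0..<n. 1 - c * (a (i + 1) - a i))"
      using ma by (elim conjE)
    have gap: "\<delta> < a (i + 1) - a i" if "i < m" for i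
    proof (cases "i + 2 \<le> m")
      case False
      then have "m = i + 1" using that by simp
      with outer show ?thesis by simp
    qed (use inner in auto)
    have prod: "tail D (a n) = tail D (a 0) * (\<Prod>i = 0..<n. 1 - c * (a (i + 1) - a i))" if "n \<le> m - 1" for n
      using tails that unfolding G by (cases "n = 0") auto
    have "tail D (a m) = 0"
    proof (rule D.tail_eq_0_above_supp)
      fix s assume "s \<in> supp (cdf D)"
      then have "ereal s \<le> omega_df F"
        unfolding omega_df_def F by (intro Sup_upper) auto
      also have "\<dots> = ereal (a m)" using omega by simp
      finally show "s \<le> a m" by simp
    qed
    then have "tail D (a (i + 1)) = tail D (a i) * (1 - c * (a (i + 1) - a i))" if "i < m" for i
    proof (cases "i + 2 \<le> m")
      case True
      then show ?thesis using prod[of i] prod[of "i + 1"] by simp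
    next
      case False
      then have "m = i + 1" using that by simp
      then have "1 - c * (a (i + 1) - a i) = 0" using last c by simp
      then show ?thesis using \<open>tail D (a m) = 0\<close> \<open>m = i + 1\<close> by simp
    qed
    then have "\<forall>x\<in>supp (cdf D). drift c \<delta> D x = 0"
      using D.drift_zero_on_finite_supp_iff[OF intD a \<delta> gap] by blast
    then show "AE x in D. drift c \<delta> D x = 0"
      using D.AE_mem_supp by (auto elim: eventually_mono)
  qed
  finally show ?thesis .
qed


end
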